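(* Let $\gamma:I\to M\subset G^3$ be a unit speed geodesic curve on a surface $M$ in the Galilean space $G^3$ (that is, $\kappa_g\equiv0$) that is a generalized helix. Then the position vectors of the special Smarandache curves of $\gamma$ are $$\alpha^g_{gh\,\mathbf{TN}}(x)=\left(1,\ \tfrac1d\sin\Big(d\int\kappa_n dx\Big)+\cos\Big(d\int\kappa_n dx\Big),\ \tfrac1d\cos\Big(d\int\kappa_n dx\Big)-\sin\Big(d\int\kappa_n dx\Big)\right),$$ $$\alpha^g_{gh\,\mathbf{TB}}(x)=\left(1,\ \tfrac1d\sin\Big(d\int\kappa_n dx\Big)+\sin\Big(d\int\kappa_n dx\Big),\ \tfrac1d\cos\Big(d\int\kappa_n dx\Big)+\cos\Big(d\int\kappa_n dx\Big)\right),$$ $$\alpha^g_{gh\,\mathbf{TNB}}(x)=\left(1,\ \tfrac{d+1}{d}\sin\Big(d\int\kappa_n dx\Big)+\cos\Big(d\int\kappa_n dx\Big),\ \tfrac{d+1}{d}\cos\Big(d\int\kappa_n dx\Big)-\sin\Big(d\int\kappa_n dx\Big)\right),$$ where $d$ is a constant (with $\tau_g=d\,\kappa_n$).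
   Context: Galilean space $G^3$ is $\mathbb{R}^3$ with scalar product $v\cdot_G w=v_1w_1$ if $v_1\ne0$ or $w_1\neq 0$, and $v\cdot_G w=v_2w_2+v_3w_3$ if $v_1=w_1=0$; norm $\|v\|_G=\sqrt{|v\cdot_G v|}$; cross product $v\times_G w=(0,\ v_3w_1-v_1w_3,\ v_1w_2-v_2w_1)$. A vector is isotropic if its first component is $0$. A unit speed curve is written $\gamma(x)=(x,y(x),z(x))$, $x\in I\subset\mathbb{R}$; its curvature is $\kappa=\|\gamma''\|_G$ (assumed $>0$), its torsion is $\tau=\det(\gamma',\gamma'',\gamma''')/\kappa^2$, and its Frenet frame is $\mathbf T=\gamma'$, $\mathbf N=\gamma''/\kappa$, $\mathbf B=\mathbf T\times_G\mathbf N=\frac1\kappa(0,-z'',y'')$. For a curve $\gamma$ on a surface $M$, $\mathbf n$ is the unit normal vector field of $M$ along $\gamma$ (the isotropic unit vector field in the direction of $\phi_u\times_G\phi_v$ for a local parametrization $\phi(u,v)$ of $M$), and $\mathbf Q=\mathbf n\times_G\mathbf T$. The geodesic curvature $\kappa_g$, normal curvature $\kappa_n$ and geodesic torsion $\tau_g$ are the functions of $x$ in the Darboux formulas $\mathbf T'=\kappa_g\mathbf Q+\kappa_n\mathbf n$, $\mathbf Q'=\tau_g\mathbf n$, $\mathbf n'=-\tau_g\mathbf Q$. One has $\kappa^2=\kappa_g^2+\kappa_n^2$. A generalized helix is a curve with $\tau/\kappa$ constant. Special Smarandache curves of $\gamma$ (here denoted $\alpha^g_{gh}$ with the corresponding subscript):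 the $\mathbf{TN}$ curve is $\mathbf T+\mathbf N$, the $\mathbf{TB}$ curve is $\mathbf T+\mathbf B$, the $\mathbf{TNB}$ curve is $\mathbf T+\mathbf N+\mathbf B$. Integral signs denote indefinite integrals.
   Formalization: Formulas are proved for d≠0, with the unit normal chosen so that n=N, and only up to a Galilean isometry of γ; since τ_g=dκ_n conflicts in sign with them, that isometry may reverse orientation, and orientation-preserving motions give them with −d in place of d. *)

theory Defs
  imports "HOL-Analysis.Analysis"
begin

definition galilean_inner :: "real^3 \<Rightarrow> real^3 \<Rightarrow> real" (infixl "\<bullet>\<^sub>G" 70) where
  "v \<bullet>\<^sub>G w = (if v $ 1 \<noteq> 0 \<or> w $ 1 \<noteq> 0 then v $ 1 * w $ 1
              else v $ 2 * w $ 2 + v $ 3 * w $ 3)"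

definition galilean_norm :: "real^3 \<Rightarrow> real" where
  "galilean_norm v = sqrt \<bar>v \<bullet>\<^sub>G v\<bar>"

definition galilean_cross :: "real^3 \<Rightarrow> real^3 \<Rightarrow> real^3" (infixl "\<times>\<^sub>G" 75) where
  "v \<times>\<^sub>G w = vector [0, v $ 3 * w $ 1 - v $ 1 * w $ 3, v $ 1 * w $ 2 - v $ 2 * w $ 1]"

(* The linear parts of these affine maps are exactly
   (x, y, z) \<mapsto> (\<plusminus>x, a x + y', b x + z') with (y', z') the image of (y, z) under an
   orthogonal map of the plane.  Reflections are included: for a geodesic with normal n = N and
   tg = d kn, N turns in the isotropic plane with angular velocity d kn, whereas
   (0, cos (d K), - sin (d K)) with K' = kn turns with angular velocity - d kn. *)
definition galilean_isometry :: "(real^3 \<Rightarrow> real^3) \<Rightarrow> bool" where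
  "galilean_isometry F \<longleftrightarrow>
     (\<exists>L b. linear L \<and> (\<forall>v w. L v \<bullet>\<^sub>G L w = v \<bullet>\<^sub>G w) \<and> F = (\<lambda>p. L p + b))"

definition galilean_motion :: "(real^3 \<Rightarrow> real^3) \<Rightarrow> bool" where
  "galilean_motion F \<longleftrightarrow>
     (\<exists>L b. linear L \<and> (\<forall>v w. L v \<bullet>\<^sub>G L w = v \<bullet>\<^sub>G w) \<and> det (matrix L) = 1 \<and> F = (\<lambda>p. L p + b))"

definition frenet_T :: "(real \<Rightarrow> real^3) \<Rightarrow> real \<Rightarrow> real^3" where
  "frenet_T \<gamma> x = vector_derivative \<gamma> (at x)"

definition second_deriv :: "(real \<Rightarrow> real^3) \<Rightarrow> real \<Rightarrow> real^3" where
  "second_deriv \<gamma> x = vector_derivative (frenet_T \<gamma>) (at x)"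

definition third_deriv :: "(real \<Rightarrow> real^3) \<Rightarrow> real \<Rightarrow> real^3" where
  "third_deriv \<gamma> x = vector_derivative (second_deriv \<gamma>) (at x)"

definition curvature :: "(real \<Rightarrow> real^3) \<Rightarrow> real \<Rightarrow> real" where
  "curvature \<gamma> x = galilean_norm (second_deriv \<gamma> x)"

definition torsion :: "(real \<Rightarrow> real^3) \<Rightarrow> real \<Rightarrow> real" where
  "torsion \<gamma> x =
     det (vector [frenet_T \<gamma> x, second_deriv \<gamma> x, third_deriv \<gamma> x] :: real^3^3) / (curvature \<gamma> x)\<^sup>2"

definition frenet_N :: "(real \<Rightarrow> real^3) \<Rightarrow> real \<Rightarrow> real^3" where
  "frenet_N \<gamma> x = (1 / curvature \<gamma> x) *\<^sub>R second_deriv \<gamma> x"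

definition frenet_B :: "(real \<Rightarrow> real^3) \<Rightarrow> real \<Rightarrow> real^3" where
  "frenet_B \<gamma> x = frenet_T \<gamma> x \<times>\<^sub>G frenet_N \<gamma> x"

definition unit_speed_curve :: "real set \<Rightarrow> (real \<Rightarrow> real^3) \<Rightarrow> bool" where
  "unit_speed_curve I \<gamma> \<longleftrightarrow>
     open I \<and> is_interval I \<and> I \<noteq> {} \<and>
     (\<forall>x\<in>I. \<gamma> x $ 1 = x \<and> \<gamma> differentiable at x \<and> frenet_T \<gamma> differentiable at x \<and>
            second_deriv \<gamma> differentiable at x \<and> curvature \<gamma> x > 0)"

definition generalized_helix :: "real set \<Rightarrow> (real \<Rightarrow> real^3) \<Rightarrow> bool" where
  "generalized_helix I \<gamma> \<longleftrightarrow> (\<exists>c. \<forall>x\<in>I. torsion \<gamma> x / curvature \<gamma> x = c)"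

definition smarandache_TN :: "(real \<Rightarrow> real^3) \<Rightarrow> real \<Rightarrow> real^3" where
  "smarandache_TN \<gamma> x = frenet_T \<gamma> x + frenet_N \<gamma> x"

definition smarandache_TB :: "(real \<Rightarrow> real^3) \<Rightarrow> real \<Rightarrow> real^3" where
  "smarandache_TB \<gamma> x = frenet_T \<gamma> x + frenet_B \<gamma> x"

definition smarandache_TNB :: "(real \<Rightarrow> real^3) \<Rightarrow> real \<Rightarrow> real^3" where
  "smarandache_TNB \<gamma> x = frenet_T \<gamma> x + frenet_N \<gamma> x + frenet_B \<gamma> x"

(* A C^1 chart with partial derivatives \<phi>u, \<phi>v.  A nonzero Galilean cross product makes the
   chart an immersion and is what the isotropic unit normal needs in order to exist. *)
definition local_parametrization ::
  "(real^3) set \<Rightarrow> (real \<times> real) set \<Rightarrow> (real \<times> real \<Rightarrow> real^3) \<Rightarrow>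
   (real \<times> real \<Rightarrow> real^3) \<Rightarrow> (real \<times> real \<Rightarrow> real^3) \<Rightarrow> bool" where
  "local_parametrization M U \<phi> \<phi>u \<phi>v \<longleftrightarrow>
     open U \<and> openin (top_of_set M) (\<phi> ` U) \<and> (\<exists>\<psi>. homeomorphism U (\<phi> ` U) \<phi> \<psi>) \<and>
     continuous_on U \<phi>u \<and> continuous_on U \<phi>v \<and>
     (\<forall>p\<in>U. (\<phi> has_derivative (\<lambda>h. fst h *\<^sub>R \<phi>u p + snd h *\<^sub>R \<phi>v p)) (at p) \<and>
            \<phi>u p \<times>\<^sub>G \<phi>v p \<noteq> 0)"

definition galilean_surface :: "(real^3) set \<Rightarrow> bool" where
  "galilean_surface M \<longleftrightarrow>
     (\<forall>q\<in>M. \<exists>U \<phi> \<phi>u \<phi>v. local_parametrization M U \<phi> \<phi>u \<phi>v \<and> q \<in> \<phi> ` U)"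

(* Pointwise n is determined up to sign, since exchanging the two parameters of a chart
   reverses it.  That n varies smoothly along the curve is imposed by the Darboux formulas below. *)
definition unit_normal_along ::
  "(real^3) set \<Rightarrow> real set \<Rightarrow> (real \<Rightarrow> real^3) \<Rightarrow> (real \<Rightarrow> real^3) \<Rightarrow> bool" where
  "unit_normal_along M I \<gamma> n \<longleftrightarrow>
     (\<forall>x\<in>I. \<exists>U \<phi> \<phi>u \<phi>v p. local_parametrization M U \<phi> \<phi>u \<phi>v \<and> p \<in> U \<and> \<phi> p = \<gamma> x \<and>
        n x = (1 / galilean_norm (\<phi>u p \<times>\<^sub>G \<phi>v p)) *\<^sub>R (\<phi>u p \<times>\<^sub>G \<phi>v p))"

definition darboux_Q :: "(real \<Rightarrow> real^3) \<Rightarrow> (real \<Rightarrow> real^3) \<Rightarrow> real \<Rightarrow> real^3" where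
  "darboux_Q \<gamma> n x = n x \<times>\<^sub>G frenet_T \<gamma> x"

(* Since Q and n are linearly independent, kg, kn and tg are determined on I by the curve and n. *)
definition darboux_functions ::
  "real set \<Rightarrow> (real \<Rightarrow> real^3) \<Rightarrow> (real \<Rightarrow> real^3) \<Rightarrow>
   (real \<Rightarrow> real) \<Rightarrow> (real \<Rightarrow> real) \<Rightarrow> (real \<Rightarrow> real) \<Rightarrow> bool" where
  "darboux_functions I \<gamma> n kg kn tg \<longleftrightarrow>
     (\<forall>x\<in>I.
        (frenet_T \<gamma> has_vector_derivative (kg x *\<^sub>R darboux_Q \<gamma> n x + kn x *\<^sub>R n x)) (at x) \<and>
        (darboux_Q \<gamma> n has_vector_derivative (tg x *\<^sub>R n x)) (at x) \<and>
        (n has_vector_derivative (- tg x *\<^sub>R darboux_Q \<gamma> n x)) (at x))"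

(* Replacing n by -n turns (kg, kn, tg) into (-kg, -kn, tg), so vanishing of kg does not
   depend on the choice of n. *)
definition geodesic_on :: "(real^3) set \<Rightarrow> real set \<Rightarrow> (real \<Rightarrow> real^3) \<Rightarrow> bool" where
  "geodesic_on M I \<gamma> \<longleftrightarrow>
     \<gamma> ` I \<subseteq> M \<and>
     (\<exists>n kg kn tg. unit_normal_along M I \<gamma> n \<and> darboux_functions I \<gamma> n kg kn tg \<and>
        (\<forall>x\<in>I. kg x = 0))"

end

theory Submission
  imports Defs
begin

text \<open>
  For a geodesic the Darboux formulas say that \<open>\<gamma>'' = kn n\<close> and that the isotropic vector \<open>n\<close>
  turns with angular velocity \<open>tg\<close>.  Since \<open>kn\<close> is continuous and never zero, exchanging the chart
  parameters (which reverses \<open>n\<close>) makes it positive; then \<open>n = N\<close>, the torsion is \<open>tg\<close>, and the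
  helix condition reads \<open>tg = d kn\<close>.  Hence the components of \<open>n\<close> in a frame turning by the angle
  \<open>d K\<close> are constant, and integrating \<open>T' = K' n\<close> gives \<open>T\<close> up to a constant isotropic vector.
  A rotation or reflection of the isotropic plane absorbs the first constants, a shear absorbs
  the second.
\<close>

section \<open>Isotropic vectors and affine maps\<close>

lemma galilean_cross_nth [simp]:
  "(v \<times>\<^sub>G w) $ 1 = 0"
  "(v \<times>\<^sub>G w) $ 2 = v $ 3 * w $ 1 - v $ 1 * w $ 3"
  "(v \<times>\<^sub>G w) $ 3 = v $ 1 * w $ 2 - v $ 2 * w $ 1"
  by (simp_all add: galilean_cross_def)

lemma galilean_cross_commute: "w \<times>\<^sub>G v = - (v \<times>\<^sub>G w)"
  by (simp add: vec_eq_iff forall_3)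

lemma galilean_norm_minus [simp]: "galilean_norm (- v) = galilean_norm v"
  by (simp add: galilean_norm_def galilean_inner_def)

lemma galilean_norm_isotropic: "v $ 1 = 0 \<Longrightarrow> galilean_norm v = sqrt ((v $ 2)\<^sup>2 + (v $ 3)\<^sup>2)"
  by (simp add: galilean_norm_def galilean_inner_def power2_eq_square)

lemma normalized_isotropic:
  assumes "v $ 1 = 0" "v \<noteq> 0"
  defines "n \<equiv> (1 / galilean_norm v) *\<^sub>R v"
  shows "n $ 1 = 0" "(n $ 2)\<^sup>2 + (n $ 3)\<^sup>2 = 1"
proof -
  show "n $ 1 = 0" by (simp add: n_def assms)
  have "v $ 2 \<noteq> 0 \<or> v $ 3 \<noteq> 0"
    using assms by (simp add: vec_eq_iff forall_3)
  then have pos: "(v $ 2)\<^sup>2 + (v $ 3)\<^sup>2 > 0"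
    by (simp only: sum_power2_gt_zero_iff)
  then show "(n $ 2)\<^sup>2 + (n $ 3)\<^sup>2 = 1"
    by (auto simp: n_def galilean_norm_isotropic[OF assms(1)] power_divide
        simp flip: add_divide_distrib)
qed

text \<open>With \<open>v $ 2 + i * v $ 3\<close> read as a complex number, the isotropic part is
  multiplied by the conjugate of \<open>p + i * q\<close> and then, if \<open>e = -1\<close>,
  conjugated. The shear by \<open>a\<close> and \<open>b\<close> fixes isotropic vectors, so it can
  shift \<open>T\<close>, whose first coordinate is 1, without changing \<open>N\<close>.\<close>

definition galilean_linear :: "real \<Rightarrow> real \<Rightarrow> real \<Rightarrow> real \<Rightarrow> real \<Rightarrow> real^3 \<Rightarrow> real^3" where
  "galilean_linear a b p q e v =
     vector [v $ 1, a * v $ 1 + (p * v $ 2 + q * v $ 3), b * v $ 1 + e * (p * v $ 3 - q * v $ 2)]"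

lemma galilean_linear_nth [simp]:
  "galilean_linear a b p q e v $ 1 = v $ 1"
  "galilean_linear a b p q e v $ 2 = a * v $ 1 + (p * v $ 2 + q * v $ 3)"
  "galilean_linear a b p q e v $ 3 = b * v $ 1 + e * (p * v $ 3 - q * v $ 2)"
  by (simp_all add: galilean_linear_def)

lemma linear_galilean_linear: "linear (galilean_linear a b p q e)"
  by (rule linearI) (simp_all add: vec_eq_iff forall_3 algebra_simps)

text \<open>The first coordinate is fixed, so both sides fall into the same branch of the inner
  product. On two isotropic vectors the shear vanishes and an orthogonal map of the plane
  remains.\<close>

lemma galilean_inner_galilean_linear:
  assumes "p\<^sup>2 + q\<^sup>2 = 1" "e\<^sup>2 = 1"
  shows "galilean_linear a b p q e v \<bullet>\<^sub>G galilean_linear a b p q e w = v \<bullet>\<^sub>G w"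
proof (cases "v $ 1 \<noteq> 0 \<or> w $ 1 \<noteq> 0")
  case True
  then show ?thesis by (auto simp: galilean_inner_def)
next
  case False
  have "(p * v $ 2 + q * v $ 3) * (p * w $ 2 + q * w $ 3)
      + e * (p * v $ 3 - q * v $ 2) * (e * (p * w $ 3 - q * w $ 2))
      = v $ 2 * w $ 2 + v $ 3 * w $ 3"
    using assms by algebra
  with False show ?thesis by (simp add: galilean_inner_def)
qed

lemma det_galilean_linear: "det (matrix (galilean_linear a b p q e)) = e * (p\<^sup>2 + q\<^sup>2)"
  by (simp add: det_3 matrix_def axis_def power2_eq_square algebra_simps)

lemma galilean_isometry_galilean_linear:
  assumes "p\<^sup>2 + q\<^sup>2 = 1" "e\<^sup>2 = 1"
  shows "galilean_isometry (galilean_linear a b p q e)"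
  unfolding galilean_isometry_def
  using linear_galilean_linear galilean_inner_galilean_linear[OF assms]
  by (intro exI[of _ "galilean_linear a b p q e"] exI[of _ 0]) auto

lemma galilean_motion_galilean_linear:
  assumes "p\<^sup>2 + q\<^sup>2 = 1"
  shows "galilean_motion (galilean_linear a b p q 1)"
  unfolding galilean_motion_def
  using linear_galilean_linear galilean_inner_galilean_linear[OF assms, of 1] assms
  by (intro exI[of _ "galilean_linear a b p q 1"] exI[of _ 0]) (auto simp: det_galilean_linear)

section \<open>Frenet vectors\<close>

lemma linear_has_vector_derivative:
  fixes L :: "'a::euclidean_space \<Rightarrow> 'b::real_normed_vector"
  assumes "linear L" "(f has_vector_derivative f') F"
  shows "((L \<circ> f) has_vector_derivative L f') F"
  using bounded_linear.has_vector_derivative assms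
  by (auto simp: o_def linear_conv_bounded_linear)

lemma unit_speed_derivatives:
  assumes "unit_speed_curve I \<gamma>" "x \<in> I"
  shows "(\<gamma> has_vector_derivative frenet_T \<gamma> x) (at x)"
    and "(frenet_T \<gamma> has_vector_derivative second_deriv \<gamma> x) (at x)"
    and "(second_deriv \<gamma> has_vector_derivative third_deriv \<gamma> x) (at x)"
  using assms
  by (simp_all add: unit_speed_curve_def frenet_T_def[of \<gamma> x] second_deriv_def[of \<gamma> x]
      third_deriv_def[of \<gamma> x] vector_derivative_works)

lemma has_real_derivative_nth:
  assumes "((f :: real \<Rightarrow> real^'n) has_vector_derivative f') F"
  shows "((\<lambda>x. f x $ i) has_real_derivative f' $ i) F"
  using bounded_linear.has_vector_derivative[OF bounded_linear_vec_nth assms]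
  by (simp add: has_real_derivative_iff_has_vector_derivative)

lemma unit_speed_T_nth_1:
  assumes "unit_speed_curve I \<gamma>" "x \<in> I"
  shows "frenet_T \<gamma> x $ 1 = 1"
proof -
  have "((\<lambda>x. \<gamma> x $ 1) has_real_derivative 1) (at x)"
    by (rule has_field_derivative_transform_within_open[where f = "\<lambda>x. x" and S = I])
      (use assms in \<open>auto simp: unit_speed_curve_def\<close>)
  with has_real_derivative_nth[OF unit_speed_derivatives(1)[OF assms], of 1] show ?thesis
    by (rule DERIV_unique)
qed

context
  fixes I :: "real set" and \<gamma> :: "real \<Rightarrow> real^3" and L :: "real^3 \<Rightarrow> real^3"
  assumes \<gamma>: "unit_speed_curve I \<gamma>" and L: "linear L" "\<And>v w. L v \<bullet>\<^sub>G L w = v \<bullet>\<^sub>G w"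
begin

lemma frenet_T_isometry: "x \<in> I \<Longrightarrow> frenet_T (L \<circ> \<gamma>) x = L (frenet_T \<gamma> x)"
  unfolding frenet_T_def[of "L \<circ> \<gamma>"]
  by (intro vector_derivative_at linear_has_vector_derivative L unit_speed_derivatives[OF \<gamma>])

lemma second_deriv_isometry:
  assumes "x \<in> I"
  shows "second_deriv (L \<circ> \<gamma>) x = L (second_deriv \<gamma> x)"
proof -
  have "((L \<circ> frenet_T \<gamma>) has_vector_derivative L (second_deriv \<gamma> x)) (at x)"
    by (intro linear_has_vector_derivative L unit_speed_derivatives[OF \<gamma>] assms)
  \<comment> \<open>The formula for the tangent holds only on \<open>I\<close>, which suffices for
    the derivative at \<open>x\<close> because \<open>I\<close> is open.\<close>
  then have "(frenet_T (L \<circ> \<gamma>) has_vector_derivative L (second_deriv \<gamma> x)) (at x)"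
    by (rule has_vector_derivative_transform_within_open[where S = I])
      (use \<gamma> assms in \<open>auto simp: frenet_T_isometry unit_speed_curve_def\<close>)
  then show ?thesis
    unfolding second_deriv_def[of "L \<circ> \<gamma>"] by (rule vector_derivative_at)
qed

text \<open>\<open>L\<close> preserves the curvature, so only the second derivative is transformed.
  The same law fails for \<open>B\<close> when \<open>L\<close> reflects the isotropic plane, so
  \<open>B\<close> is later computed from the transformed \<open>T\<close> and
  \<open>N\<close>.\<close>

lemma frenet_N_isometry: "x \<in> I \<Longrightarrow> frenet_N (L \<circ> \<gamma>) x = L (frenet_N \<gamma> x)"
  by (simp add: frenet_N_def curvature_def second_deriv_isometry galilean_norm_def L linear_cmul)

end

section \<open>Reversing the normal\<close>

text \<open>The exchanged chart covers the same piece of \<open>M\<close> but has the opposite cross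
  product of partial derivatives.\<close>

lemma local_parametrization_swap:
  assumes "local_parametrization M U \<phi> \<phi>u \<phi>v"
  shows "local_parametrization M (prod.swap ` U) (\<phi> \<circ> prod.swap) (\<phi>v \<circ> prod.swap) (\<phi>u \<circ> prod.swap)"
proof -
  note A = assms[unfolded local_parametrization_def]
  have cont: "continuous_on S (prod.swap :: real \<times> real \<Rightarrow> _)" for S
    unfolding prod.swap_def by (intro continuous_intros)
  have hom: "homeomorphism (prod.swap ` U) U prod.swap prod.swap"
    by (auto simp: homeomorphism_def cont image_image)
  \<comment> \<open>The swap is its own inverse, so the image is a preimage and openness follows
    from continuity.\<close>
  have "prod.swap ` U = prod.swap -` U"
    by force
  then have "open (prod.swap ` U)"
    using A open_vimage[OF _ cont] by auto
  moreover have img: "(\<phi> \<circ> prod.swap) ` prod.swap ` U = \<phi> ` U"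
    by (simp add: image_image)
  moreover have "\<exists>\<psi>. homeomorphism (prod.swap ` U) (\<phi> ` U) (\<phi> \<circ> prod.swap) \<psi>"
    using A homeomorphism_compose[OF hom] by blast
  moreover have "continuous_on (prod.swap ` U) (g \<circ> prod.swap)" if "continuous_on U g"
    for g :: "real \<times> real \<Rightarrow> real^3"
    using that by (intro continuous_on_compose cont) (simp add: image_image)
  moreover have "((\<phi> \<circ> prod.swap) has_derivative
      (\<lambda>h. fst h *\<^sub>R \<phi>v (prod.swap p) + snd h *\<^sub>R \<phi>u (prod.swap p))) (at p)"
    if "prod.swap p \<in> U" for p
  proof -
    have "(prod.swap has_derivative prod.swap) (at p)"
      unfolding prod.swap_def by (intro derivative_eq_intros) auto
    from diff_chain_at[OF this, of \<phi> "\<lambda>h. fst h *\<^sub>R \<phi>u (prod.swap p) + snd h *\<^sub>R \<phi>v (prod.swap p)"]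
    show ?thesis
      using A that by (simp add: o_def add.commute)
  qed
  moreover have "\<phi>v p \<times>\<^sub>G \<phi>u p \<noteq> 0" if "p \<in> U" for p
    using A that galilean_cross_commute[of "\<phi>v p" "\<phi>u p"] by auto
  ultimately show ?thesis
    using A by (auto simp: local_parametrization_def)
qed

lemma unit_normal_along_minus:
  assumes "unit_normal_along M I \<gamma> n"
  shows "unit_normal_along M I \<gamma> (\<lambda>x. - n x)"
  unfolding unit_normal_along_def
proof
  fix x assume "x \<in> I"
  then obtain U \<phi> \<phi>u \<phi>v p where *: "local_parametrization M U \<phi> \<phi>u \<phi>v" "p \<in> U" "\<phi> p = \<gamma> x"
    "n x = (1 / galilean_norm (\<phi>u p \<times>\<^sub>G \<phi>v p)) *\<^sub>R (\<phi>u p \<times>\<^sub>G \<phi>v p)"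
    using assms unfolding unit_normal_along_def by blast
  show "\<exists>U \<phi> \<phi>u \<phi>v p. local_parametrization M U \<phi> \<phi>u \<phi>v \<and> p \<in> U \<and> \<phi> p = \<gamma> x \<and>
        - n x = (1 / galilean_norm (\<phi>u p \<times>\<^sub>G \<phi>v p)) *\<^sub>R (\<phi>u p \<times>\<^sub>G \<phi>v p)"
    by (rule exI[of _ "prod.swap ` U"], rule exI[of _ "\<phi> \<circ> prod.swap"],
        rule exI[of _ "\<phi>v \<circ> prod.swap"], rule exI[of _ "\<phi>u \<circ> prod.swap"],
        rule exI[of _ "prod.swap p"])
      (use * local_parametrization_swap[OF *(1)] galilean_cross_commute[of "\<phi>v p" "\<phi>u p"] in auto)
qed

text \<open>\<open>Q\<close> is linear in \<open>n\<close> and reverses with it. The derivative of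
  \<open>T\<close> stays the same, which forces the sign changes of \<open>kg\<close> and
  \<open>kn\<close>; \<open>tg\<close> relates two vectors that both reverse.\<close>

lemma darboux_functions_minus:
  assumes "darboux_functions I \<gamma> n kg kn tg"
  shows "darboux_functions I \<gamma> (\<lambda>x. - n x) (\<lambda>x. - kg x) (\<lambda>x. - kn x) tg"
proof -
  have Q: "darboux_Q \<gamma> (\<lambda>x. - n x) = (\<lambda>x. - darboux_Q \<gamma> n x)"
    by (simp add: fun_eq_iff darboux_Q_def vec_eq_iff forall_3)
  show ?thesis
    unfolding darboux_functions_def Q
    using assms[unfolded darboux_functions_def]
    by (auto dest!: bspec dest: has_vector_derivative_minus)
qed

lemma unit_normal_along_isotropic:
  assumes "unit_normal_along M I \<gamma> n" "x \<in> I"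
  shows "n x $ 1 = 0" "(n x $ 2)\<^sup>2 + (n x $ 3)\<^sup>2 = 1"
proof -
  obtain U \<phi> \<phi>u \<phi>v p where "local_parametrization M U \<phi> \<phi>u \<phi>v" "p \<in> U"
    "n x = (1 / galilean_norm (\<phi>u p \<times>\<^sub>G \<phi>v p)) *\<^sub>R (\<phi>u p \<times>\<^sub>G \<phi>v p)"
    using assms unfolding unit_normal_along_def by blast
  then show "n x $ 1 = 0" "(n x $ 2)\<^sup>2 + (n x $ 3)\<^sup>2 = 1"
    using normalized_isotropic[of "\<phi>u p \<times>\<^sub>G \<phi>v p"]
    by (auto simp: local_parametrization_def)
qed

section \<open>Geodesics\<close>

text \<open>The normal and its Darboux functions are parameters, so that the reversed data form
  another instance.\<close>

locale geodesic_darboux =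
  fixes M :: "(real^3) set" and I :: "real set" and \<gamma> n :: "real \<Rightarrow> real^3"
    and kg kn tg :: "real \<Rightarrow> real"
  assumes unit_speed: "unit_speed_curve I \<gamma>"
    and normal: "unit_normal_along M I \<gamma> n"
    and darboux: "darboux_functions I \<gamma> n kg kn tg"
    and geodesic: "x \<in> I \<Longrightarrow> kg x = 0"
begin

lemma open_I: "open I" and interval_I: "is_interval I" and nonempty_I: "I \<noteq> {}"
  using unit_speed by (auto simp: unit_speed_curve_def)

lemmas n_isotropic = unit_normal_along_isotropic[OF normal]

lemma reverse: "geodesic_darboux M I \<gamma> (\<lambda>x. - n x) (\<lambda>x. - kg x) (\<lambda>x. - kn x) tg"
  using unit_speed unit_normal_along_minus[OF normal] darboux_functions_minus[OF darboux] geodesic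
  by unfold_locales auto

lemma second_deriv_eq:
  assumes "x \<in> I"
  shows "second_deriv \<gamma> x = kn x *\<^sub>R n x"
proof -
  have "(frenet_T \<gamma> has_vector_derivative kn x *\<^sub>R n x) (at x)"
    using darboux geodesic assms by (auto simp: darboux_functions_def)
  then show ?thesis
    unfolding second_deriv_def by (rule vector_derivative_at)
qed

lemma curvature_eq: "x \<in> I \<Longrightarrow> curvature \<gamma> x = \<bar>kn x\<bar>"
  using n_isotropic
  by (simp add: curvature_def second_deriv_eq galilean_norm_isotropic power_mult_distrib
      flip: distrib_left)

lemma kn_nonzero: "x \<in> I \<Longrightarrow> kn x \<noteq> 0"
  using unit_speed curvature_eq by (force simp: unit_speed_curve_def)

text \<open>Since \<open>n\<close> is isotropic and \<open>T\<close> has first coordinate 1,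
  \<open>Q\<close> is \<open>n\<close> turned by a negative quarter turn in the isotropic plane. The
  Darboux formula for \<open>n\<close> is thus a rotation with angular velocity
  \<open>tg\<close>.\<close>

lemma n_derivatives:
  assumes "x \<in> I"
  shows "((\<lambda>x. n x $ 2) has_real_derivative - tg x * n x $ 3) (at x)"
    and "((\<lambda>x. n x $ 3) has_real_derivative tg x * n x $ 2) (at x)"
proof -
  have "(n has_vector_derivative - tg x *\<^sub>R darboux_Q \<gamma> n x) (at x)"
    using darboux assms by (simp add: darboux_functions_def)
  from has_real_derivative_nth[OF this, of 2] has_real_derivative_nth[OF this, of 3]
  show "((\<lambda>x. n x $ 2) has_real_derivative - tg x * n x $ 3) (at x)"
    "((\<lambda>x. n x $ 3) has_real_derivative tg x * n x $ 2) (at x)"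
    using n_isotropic[OF assms] unit_speed_T_nth_1[OF unit_speed assms]
    by (simp_all add: darboux_Q_def)
qed

lemma T_derivatives:
  assumes "x \<in> I"
  shows "((\<lambda>x. frenet_T \<gamma> x $ i) has_real_derivative kn x * n x $ i) (at x)"
  using has_real_derivative_nth[OF unit_speed_derivatives(2)[OF unit_speed assms], of i]
  by (simp add: second_deriv_eq[OF assms])

lemmas second_derivatives = has_real_derivative_nth[OF unit_speed_derivatives(3)[OF unit_speed]]

text \<open>A continuous function without zeros on an interval keeps its sign.\<close>

lemma kn_sign: "(\<forall>x\<in>I. kn x > 0) \<or> (\<forall>x\<in>I. kn x < 0)"
proof -
  \<comment> \<open>\<open>kn\<close> is given only as a coefficient; as the plane scalar product of
    the second derivative with the unit vector \<open>n\<close> it is seen to be continuous.\<close>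
  let ?k = "\<lambda>x. second_deriv \<gamma> x $ 2 * n x $ 2 + second_deriv \<gamma> x $ 3 * n x $ 3"
  have eq: "?k x = kn x" if "x \<in> I" for x
  proof -
    have "?k x = kn x * ((n x $ 2)\<^sup>2 + (n x $ 3)\<^sup>2)"
      by (simp add: second_deriv_eq that power2_eq_square algebra_simps)
    then show ?thesis
      by (simp add: n_isotropic that)
  qed
  have "isCont ?k x" if "x \<in> I" for x
    using that n_derivatives second_derivatives by (intro continuous_intros DERIV_isCont) auto
  then have "continuous_on I ?k"
    by (simp add: continuous_at_imp_continuous_on)
  then have "continuous_on I kn"
    by (simp add: eq cong: continuous_on_cong)
  then have conn: "connected (kn ` I)"
    using interval_I by (simp add: connected_continuous_image is_interval_connected)
  have "\<not> (kn x < 0 \<and> kn y > 0)" if "x \<in> I" "y \<in> I" for x y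
    using connectedD_interval[OF conn, of "kn x" "kn y" 0] that kn_nonzero by fastforce
  then show ?thesis
    using kn_nonzero by (meson linorder_neqE_linordered_idom)
qed

text \<open>The second derivative is parallel to \<open>n\<close>, so their plane determinant
  \<open>?f\<close> vanishes on \<open>I\<close>. Differentiating this identity yields the needed
  part of the third derivative without differentiating \<open>kn\<close>. Only the square of
  \<open>kn\<close> enters the final quotient, so either sign of \<open>kn\<close> is
  allowed.\<close>

lemma torsion_eq:
  assumes "x \<in> I"
  shows "torsion \<gamma> x = tg x"
proof -
  let ?S = "second_deriv \<gamma>" and ?S' = "third_deriv \<gamma> x"
  let ?f = "\<lambda>x. ?S x $ 2 * n x $ 3 - ?S x $ 3 * n x $ 2"
  let ?D = "(?S' $ 2 * n x $ 3 + tg x * n x $ 2 * ?S x $ 2)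
    - (?S' $ 3 * n x $ 2 + - tg x * n x $ 3 * ?S x $ 3)"
  have "(?f has_real_derivative ?D) (at x)"
    by (intro DERIV_diff DERIV_mult second_derivatives n_derivatives assms)
  moreover have "(?f has_real_derivative 0) (at x)"
    by (rule has_field_derivative_transform_within_open[where f = "\<lambda>x. 0" and S = I])
      (use assms open_I in \<open>auto simp: second_deriv_eq\<close>)
  ultimately have "?D = 0"
    by (rule DERIV_unique)
  then have "?S' $ 3 * n x $ 2 - ?S' $ 2 * n x $ 3 = tg x * kn x"
    using n_isotropic(2)[OF assms] unfolding second_deriv_eq[OF assms] vector_scaleR_component real_scaleR_def
    by algebra
  then have "kn x * n x $ 2 * ?S' $ 3 - kn x * n x $ 3 * ?S' $ 2 = tg x * (kn x)\<^sup>2"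
    by algebra
  \<comment> \<open>With this the determinant in the torsion reduces to its isotropic 2 by 2
    block.\<close>
  moreover have "?S' $ 1 = 0"
  proof (rule DERIV_unique[OF second_derivatives[OF assms]])
    show "((\<lambda>x. ?S x $ 1) has_real_derivative 0) (at x)"
      by (rule has_field_derivative_transform_within_open[where f = "\<lambda>x. 0" and S = I])
        (use assms open_I in \<open>auto simp: second_deriv_eq n_isotropic\<close>)
  qed
  ultimately show ?thesis
    using kn_nonzero[OF assms] n_isotropic(1)[OF assms] unit_speed_T_nth_1[OF unit_speed assms]
    by (simp add: torsion_def curvature_eq[OF assms] det_3 second_deriv_eq[OF assms])
qed

section \<open>Integration of the Darboux formulas for a helix\<close>

lemma constant_on_I:
  assumes "\<And>x. x \<in> I \<Longrightarrow> (f has_real_derivative 0) (at x)"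
  obtains c where "\<And>x. x \<in> I \<Longrightarrow> f x = c"
proof -
  have "f constant_on I"
    using assms open_I is_interval_connected[OF interval_I]
    by (intro has_field_derivative_0_imp_constant_on) auto
  then show ?thesis
    using that by (auto simp: constant_on_def)
qed

text \<open>In complex notation for the isotropic plane, \<open>n\<close> times the conjugate of
  \<open>p + i * q\<close> is \<open>exp (i * d * K)\<close>. Since \<open>T' = K' * n\<close>, the
  tangent multiplied by the same constant is \<open>exp (i * d * K) / (i * d)\<close> plus the
  constant of integration \<open>a + i * b\<close>.\<close>

lemma normal_form:
  assumes tg: "\<And>x. x \<in> I \<Longrightarrow> tg x = d * kn x" and "d \<noteq> 0"
    and K: "\<And>x. x \<in> I \<Longrightarrow> (K has_real_derivative kn x) (at x)"
  obtains p q a b where "p\<^sup>2 + q\<^sup>2 = 1"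
    and "\<And>x. x \<in> I \<Longrightarrow> p * n x $ 2 + q * n x $ 3 = cos (d * K x)"
    and "\<And>x. x \<in> I \<Longrightarrow> p * n x $ 3 - q * n x $ 2 = sin (d * K x)"
    and "\<And>x. x \<in> I \<Longrightarrow> p * frenet_T \<gamma> x $ 2 + q * frenet_T \<gamma> x $ 3 = a + sin (d * K x) / d"
    and "\<And>x. x \<in> I \<Longrightarrow> p * frenet_T \<gamma> x $ 3 - q * frenet_T \<gamma> x $ 2 = b - cos (d * K x) / d"
proof -
  let ?c = "\<lambda>x. cos (d * K x)" and ?s = "\<lambda>x. sin (d * K x)"
  have c': "(?c has_real_derivative - tg x * ?s x) (at x)"
    and s': "(?s has_real_derivative tg x * ?c x) (at x)" if "x \<in> I" for x
    by (rule derivative_eq_intros K that refl | simp add: tg that)+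
  \<comment> \<open>Real and imaginary part of \<open>n * exp (- i * d * K)\<close>, called
    \<open>p\<close> and \<open>q\<close>, are constant because \<open>n\<close> and the exponential
    turn at opposite rates.\<close>
  have "((\<lambda>x. n x $ 2 * ?c x + n x $ 3 * ?s x) has_real_derivative 0) (at x)" if "x \<in> I" for x
    by (rule derivative_eq_intros n_derivatives c' s' that refl)+ (simp add: algebra_simps)
  then obtain p where p: "\<And>x. x \<in> I \<Longrightarrow> n x $ 2 * ?c x + n x $ 3 * ?s x = p"
    using constant_on_I by blast
  have "((\<lambda>x. n x $ 3 * ?c x - n x $ 2 * ?s x) has_real_derivative 0) (at x)" if "x \<in> I" for x
    by (rule derivative_eq_intros n_derivatives c' s' that refl)+ (simp add: algebra_simps)
  then obtain q where q: "\<And>x. x \<in> I \<Longrightarrow> n x $ 3 * ?c x - n x $ 2 * ?s x = q"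
    using constant_on_I by blast
  have N: "p * n x $ 2 + q * n x $ 3 = ?c x" "p * n x $ 3 - q * n x $ 2 = ?s x"
    and pq: "p\<^sup>2 + q\<^sup>2 = 1" if "x \<in> I" for x
  proof -
    \<comment> \<open>The first two identities solve for the exponential by multiplying the
      conjugate of \<open>p + i * q\<close> by \<open>n\<close>; the third is multiplicativity of
      the squared modulus.\<close>
    have rotate:
      "(u * C + v * S) * u + (v * C - u * S) * v = C * (u\<^sup>2 + v\<^sup>2)"
      "(u * C + v * S) * v - (v * C - u * S) * u = S * (u\<^sup>2 + v\<^sup>2)"
      "(u * C + v * S)\<^sup>2 + (v * C - u * S)\<^sup>2 = (u\<^sup>2 + v\<^sup>2) * (S\<^sup>2 + C\<^sup>2)"
      for u v C S :: real
      by (simp_all add: power2_eq_square algebra_simps)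
    note * = rotate[of "n x $ 2" "?c x" "n x $ 3" "?s x", unfolded p[OF that] q[OF that]]
    show "p * n x $ 2 + q * n x $ 3 = ?c x" "p * n x $ 3 - q * n x $ 2 = ?s x" "p\<^sup>2 + q\<^sup>2 = 1"
      using * n_isotropic(2)[OF that] by simp_all
  qed
  let ?T = "\<lambda>i x. frenet_T \<gamma> x $ i"
  have "((\<lambda>x. p * ?T 2 x + q * ?T 3 x - ?s x / d) has_real_derivative 0) (at x)" if "x \<in> I" for x
  proof -
    have "((\<lambda>x. p * ?T 2 x + q * ?T 3 x - ?s x / d) has_real_derivative
        p * (kn x * n x $ 2) + q * (kn x * n x $ 3) - tg x * ?c x / d) (at x)"
      by (intro DERIV_add DERIV_diff DERIV_cmult DERIV_cdivide T_derivatives s' that)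
    then show ?thesis
      using \<open>d \<noteq> 0\<close> by (simp add: tg that algebra_simps add_divide_distrib diff_divide_distrib flip: N(1)[OF that])
  qed
  then obtain a where a: "\<And>x. x \<in> I \<Longrightarrow> p * ?T 2 x + q * ?T 3 x - ?s x / d = a"
    using constant_on_I by blast
  have "((\<lambda>x. p * ?T 3 x - q * ?T 2 x + ?c x / d) has_real_derivative 0) (at x)" if "x \<in> I" for x
  proof -
    have "((\<lambda>x. p * ?T 3 x - q * ?T 2 x + ?c x / d) has_real_derivative
        p * (kn x * n x $ 3) - q * (kn x * n x $ 2) + - tg x * ?s x / d) (at x)"
      by (intro DERIV_add DERIV_diff DERIV_cmult DERIV_cdivide T_derivatives c' that)
    then show ?thesis
      using \<open>d \<noteq> 0\<close> by (simp add: tg that algebra_simps add_divide_distrib diff_divide_distrib flip: N(2)[OF that])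
  qed
  then obtain b where b: "\<And>x. x \<in> I \<Longrightarrow> p * ?T 3 x - q * ?T 2 x + ?c x / d = b"
    using constant_on_I by blast
  show thesis
  proof (rule that[OF _ N])
    show "p\<^sup>2 + q\<^sup>2 = 1" using pq nonempty_I by blast
    show "p * ?T 2 x + q * ?T 3 x = a + ?s x / d" if "x \<in> I" for x
      using a[OF that] by linarith
    show "p * ?T 3 x - q * ?T 2 x = b - ?c x / d" if "x \<in> I" for x
      using b[OF that] by linarith
  qed
qed

text \<open>The sign \<open>e\<close> stays free so that the same constants serve both the rotation
  (\<open>e = 1\<close>) and its composition with a reflection (\<open>e = -1\<close>).\<close>

lemma frenet_normal_form:
  assumes pos: "\<And>x. x \<in> I \<Longrightarrow> kn x > 0"
    and tg: "\<And>x. x \<in> I \<Longrightarrow> tg x = d * kn x" and "d \<noteq> 0"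
    and K: "\<And>x. x \<in> I \<Longrightarrow> (K has_real_derivative kn x) (at x)"
  obtains p q a b where "p\<^sup>2 + q\<^sup>2 = 1"
    and "\<And>e x. \<lbrakk>e\<^sup>2 = 1; x \<in> I\<rbrakk> \<Longrightarrow>
      frenet_T (galilean_linear a (e * b) p q e \<circ> \<gamma>) x
        = vector [1, sin (d * K x) / d, - e * cos (d * K x) / d]"
    and "\<And>e x. \<lbrakk>e\<^sup>2 = 1; x \<in> I\<rbrakk> \<Longrightarrow>
      frenet_N (galilean_linear a (e * b) p q e \<circ> \<gamma>) x
        = vector [0, cos (d * K x), e * sin (d * K x)]"
proof -
  obtain p q a b where pq: "p\<^sup>2 + q\<^sup>2 = 1"
    and n: "\<And>x. x \<in> I \<Longrightarrow> p * n x $ 2 + q * n x $ 3 = cos (d * K x)"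
      "\<And>x. x \<in> I \<Longrightarrow> p * n x $ 3 - q * n x $ 2 = sin (d * K x)"
    and T: "\<And>x. x \<in> I \<Longrightarrow> p * frenet_T \<gamma> x $ 2 + q * frenet_T \<gamma> x $ 3 = a + sin (d * K x) / d"
      "\<And>x. x \<in> I \<Longrightarrow> p * frenet_T \<gamma> x $ 3 - q * frenet_T \<gamma> x $ 2 = b - cos (d * K x) / d"
    using normal_form[OF tg \<open>d \<noteq> 0\<close> K] by blast
  \<comment> \<open>Positivity of \<open>kn\<close> gives \<open>n\<close> here; a negative
    \<open>kn\<close> would give \<open>- n\<close>.\<close>
  have N: "frenet_N \<gamma> x = n x" if "x \<in> I" for x
    using pos[OF that] by (simp add: frenet_N_def curvature_eq second_deriv_eq that)
  show thesis
  \<comment> \<open>The shear adds its coefficients to the tangent, so the negated constants of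
    integration cancel them. The second one carries the factor \<open>e\<close> because the third
    coordinate is reflected too.\<close>
  proof (rule that[of p q "- a" "- b"])
    fix e x :: real assume e: "e\<^sup>2 = 1" and x: "x \<in> I"
    note L = unit_speed linear_galilean_linear galilean_inner_galilean_linear[OF pq e]
    show "frenet_T (galilean_linear (- a) (e * - b) p q e \<circ> \<gamma>) x
        = vector [1, sin (d * K x) / d, - e * cos (d * K x) / d]"
      by (simp add: frenet_T_isometry[OF L x] vec_eq_iff forall_3 T x
          unit_speed_T_nth_1[OF unit_speed x] algebra_simps)
    show "frenet_N (galilean_linear (- a) (e * - b) p q e \<circ> \<gamma>) x
        = vector [0, cos (d * K x), e * sin (d * K x)]"
      by (simp add: frenet_N_isometry[OF L x] vec_eq_iff forall_3 N n n_isotropic x)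
  qed (rule pq)
qed

end

text \<open>The curve is determined only up to an isometry, hence \<open>F\<close>, chosen after the
  antiderivative \<open>K\<close>. The formulas with \<open>d\<close> are reached by a map that
  reverses the isotropic plane; an orientation-preserving motion reaches the same formulas with
  \<open>- d\<close>.\<close>

theorem corollary7:
  fixes M :: "(real^3) set" and I :: "real set" and \<gamma> :: "real \<Rightarrow> real^3"
  assumes "galilean_surface M"
    and "unit_speed_curve I \<gamma>"
    and "geodesic_on M I \<gamma>"
    and "generalized_helix I \<gamma>"
  shows "\<exists>n kg kn tg d.
    unit_normal_along M I \<gamma> n \<and> darboux_functions I \<gamma> n kg kn tg \<and>
    (\<forall>x\<in>I. kg x = 0) \<and> (\<forall>x\<in>I. tg x = d * kn x) \<and>
    (d \<noteq> 0 \<longrightarrow> (\<forall>K. (\<forall>x\<in>I. (K has_real_derivative kn x) (at x)) \<longrightarrow>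
      (\<exists>F. galilean_isometry F \<and> (\<forall>x\<in>I.
        smarandache_TN (F \<circ> \<gamma>) x =
          vector [1, 1 / d * sin (d * K x) + cos (d * K x),
                     1 / d * cos (d * K x) - sin (d * K x)] \<and>
        smarandache_TB (F \<circ> \<gamma>) x =
          vector [1, 1 / d * sin (d * K x) + sin (d * K x),
                     1 / d * cos (d * K x) + cos (d * K x)] \<and>
        smarandache_TNB (F \<circ> \<gamma>) x =
          vector [1, (d + 1) / d * sin (d * K x) + cos (d * K x),
                     (d + 1) / d * cos (d * K x) - sin (d * K x)])) \<and>
      (\<exists>F. galilean_motion F \<and> (\<forall>x\<in>I.
        smarandache_TN (F \<circ> \<gamma>) x =
          vector [1, 1 / (- d) * sin (- d * K x) + cos (- d * K x),
                     1 / (- d) * cos (- d * K x) - sin (- d * K x)] \<and>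
        smarandache_TB (F \<circ> \<gamma>) x =
          vector [1, 1 / (- d) * sin (- d * K x) + sin (- d * K x),
                     1 / (- d) * cos (- d * K x) + cos (- d * K x)] \<and>
        smarandache_TNB (F \<circ> \<gamma>) x =
          vector [1, (- d + 1) / (- d) * sin (- d * K x) + cos (- d * K x),
                     (- d + 1) / (- d) * cos (- d * K x) - sin (- d * K x)]))))"
proof -
  obtain n0 kg0 kn0 tg where "geodesic_darboux M I \<gamma> n0 kg0 kn0 tg"
    using assms unfolding geodesic_on_def geodesic_darboux_def by blast
  then interpret D0: geodesic_darboux M I \<gamma> n0 kg0 kn0 tg .
  \<comment> \<open>The normal is reversed if necessary, which makes \<open>kn\<close> positive and
    keeps \<open>tg\<close>.\<close>
  obtain n kg kn where "geodesic_darboux M I \<gamma> n kg kn tg" and pos: "\<And>x. x \<in> I \<Longrightarrow> kn x > 0"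
  proof (cases "\<forall>x\<in>I. kn0 x > 0")
    case True
    then show ?thesis using that D0.geodesic_darboux_axioms by blast
  next
    case False
    then show ?thesis using that[OF D0.reverse] D0.kn_sign by auto
  qed
  then interpret D: geodesic_darboux M I \<gamma> n kg kn tg by simp
  obtain d where "\<And>x. x \<in> I \<Longrightarrow> torsion \<gamma> x / curvature \<gamma> x = d"
    using assms(4) by (auto simp: generalized_helix_def)
  then have tg: "tg x = d * kn x" if "x \<in> I" for x
    using that pos[OF that] by (force simp: D.torsion_eq D.curvature_eq)
  show ?thesis
  proof (rule exI[of _ n], rule exI[of _ kg], rule exI[of _ kn], rule exI[of _ tg],
      rule exI[of _ d], intro conjI impI allI ballI)
    fix K assume "d \<noteq> 0" and K: "\<forall>x\<in>I. (K has_real_derivative kn x) (at x)"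
    obtain p q a b where pq: "p\<^sup>2 + q\<^sup>2 = 1"
      and T: "\<And>e x. \<lbrakk>e\<^sup>2 = 1; x \<in> I\<rbrakk> \<Longrightarrow> frenet_T (galilean_linear a (e * b) p q e \<circ> \<gamma>) x
        = vector [1, sin (d * K x) / d, - e * cos (d * K x) / d]"
      and N: "\<And>e x. \<lbrakk>e\<^sup>2 = 1; x \<in> I\<rbrakk> \<Longrightarrow> frenet_N (galilean_linear a (e * b) p q e \<circ> \<gamma>) x
        = vector [0, cos (d * K x), e * sin (d * K x)]"
      using D.frenet_normal_form[OF pos tg \<open>d \<noteq> 0\<close>] K by blast
    note sm = smarandache_TN_def smarandache_TB_def smarandache_TNB_def frenet_B_def
      vec_eq_iff forall_3
    \<comment> \<open>The value \<open>-1\<close> of \<open>e\<close> serves the isometry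
      \<open>?F\<close>, the value 1 the motion \<open>?G\<close>.\<close>
    note T1 = T[of "-1", simplified] T[of 1, simplified]
    note N1 = N[of "-1", simplified] N[of 1, simplified]
    let ?F = "galilean_linear a (- b) p q (- 1)" and ?G = "galilean_linear a b p q 1"
    show "\<exists>F. galilean_isometry F \<and> (\<forall>x\<in>I.
        smarandache_TN (F \<circ> \<gamma>) x =
          vector [1, 1 / d * sin (d * K x) + cos (d * K x),
                     1 / d * cos (d * K x) - sin (d * K x)] \<and>
        smarandache_TB (F \<circ> \<gamma>) x =
          vector [1, 1 / d * sin (d * K x) + sin (d * K x),
                     1 / d * cos (d * K x) + cos (d * K x)] \<and>
        smarandache_TNB (F \<circ> \<gamma>) x =
          vector [1, (d + 1) / d * sin (d * K x) + cos (d * K x),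
                     (d + 1) / d * cos (d * K x) - sin (d * K x)])"
      using \<open>d \<noteq> 0\<close> galilean_isometry_galilean_linear[OF pq, of "- 1"]
      by (intro exI[of _ ?F]) (simp add: sm T1 N1 field_simps)
    show "\<exists>F. galilean_motion F \<and> (\<forall>x\<in>I.
        smarandache_TN (F \<circ> \<gamma>) x =
          vector [1, 1 / (- d) * sin (- d * K x) + cos (- d * K x),
                     1 / (- d) * cos (- d * K x) - sin (- d * K x)] \<and>
        smarandache_TB (F \<circ> \<gamma>) x =
          vector [1, 1 / (- d) * sin (- d * K x) + sin (- d * K x),
                     1 / (- d) * cos (- d * K x) + cos (- d * K x)] \<and>
        smarandache_TNB (F \<circ> \<gamma>) x =
          vector [1, (- d + 1) / (- d) * sin (- d * K x) + cos (- d * K x),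
                     (- d + 1) / (- d) * cos (- d * K x) - sin (- d * K x)])"
      using \<open>d \<noteq> 0\<close> galilean_motion_galilean_linear[OF pq]
      by (intro exI[of _ ?G]) (simp add: sm T1 N1 field_simps)
  qed (use D.normal D.darboux D.geodesic tg in auto)
qed

end
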